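(* Let $N$ be a right nearring with identity $1$ and let $n\ge 1$. The mapping $P\mapsto P^*$ defines a one-to-one correspondence (bijection) between the set of complement ideals of $N$ and the set of complement ideals of $M_n(N)$.
   Context: A right nearring $(N,+,\cdot)$ consists of a (not necessarily abelian) group $(N,+)$ and a semigroup $(N,\cdot)$ with $(a+b)c=ac+bc$ for all $a,b,c\in N$. An ideal of $N$ is a normal subgroup $I$ of $(N,+)$ with $IN\subseteq I$ and $n(n'+i)-nn'\in I$ for all $n,n'\in N$, $i\in I$. An ideal $I$ of a nearring is a complement of an ideal $K$ if $I$ is maximal (among ideals) with respect to the property $K\cap I=\{0\}$; a complement ideal is an ideal that is a complement of some ideal. $N^n$ is the direct sum of $n$ copies of $(N,+)$. For $a\in N$ and $1\le i,j\le n$, $f_{ij}^a\colon N^n\to N^n$ sends $(x_1,\dots,x_n)$ to the vector with $ax_j$ in position $i$ and $0$ elsewhere. $M_n(N)$ is the subnearring of $M(N^n)$ (all maps $N^n\to N^n$ under pointwise addition and composition) generated by all $f_{ij}^a$, $a\in N$, $1\le i,j\le n$. For an ideal $I$ of $N$, $I^*=\{A\in M_n(N)\mid A\rho\in I^n\text{ for all }\rho\in N^n\}$, an ideal of $M_n(N)$. *)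

theory Defs
  imports "HOL-Algebra.Ring" "HOL-Algebra.Product_Groups"
begin

text \<open>
  Nearrings are represented by the ring records of HOL-Algebra. Addition is not assumed to be
  commutative, so only the group structure of \<open>add_monoid N\<close> may be used, not the locale
  \<open>abelian_group\<close>. No multiplicative identity is required in \<open>nearring\<close>; a nearring with
  identity is one for which in addition \<open>monoid N\<close> holds. Right nearrings satisfy
  \<open>\<zero> \<otimes> c = \<zero>\<close>, but they need not satisfy \<open>c \<otimes> \<zero> = \<zero>\<close>.
\<close>

locale nearring =
  fixes N :: "('a, 'b) ring_scheme" (structure)
  assumes add_group: "group (add_monoid N)"
    and m_closed: "\<lbrakk>a \<in> carrier N; b \<in> carrier N\<rbrakk> \<Longrightarrow> a \<otimes> b \<in> carrier N"
    and m_assoc: "\<lbrakk>a \<in> carrier N; b \<in> carrier N; c \<in> carrier N\<rbrakk>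
      \<Longrightarrow> (a \<otimes> b) \<otimes> c = a \<otimes> (b \<otimes> c)"
    and r_distrib: "\<lbrakk>a \<in> carrier N; b \<in> carrier N; c \<in> carrier N\<rbrakk>
      \<Longrightarrow> (a \<oplus> b) \<otimes> c = a \<otimes> c \<oplus> b \<otimes> c"

definition nearring_ideal :: "'a set \<Rightarrow> ('a, 'b) ring_scheme \<Rightarrow> bool" where
  "nearring_ideal I N \<longleftrightarrow>
     I \<lhd> add_monoid N \<and>
     (\<forall>i\<in>I. \<forall>n\<in>carrier N. i \<otimes>\<^bsub>N\<^esub> n \<in> I) \<and>
     (\<forall>n\<in>carrier N. \<forall>n'\<in>carrier N. \<forall>i\<in>I.
        (n \<otimes>\<^bsub>N\<^esub> (n' \<oplus>\<^bsub>N\<^esub> i)) \<ominus>\<^bsub>N\<^esub> (n \<otimes>\<^bsub>N\<^esub> n') \<in> I)"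

definition complement_of :: "'a set \<Rightarrow> 'a set \<Rightarrow> ('a, 'b) ring_scheme \<Rightarrow> bool" where
  "complement_of I K N \<longleftrightarrow>
     nearring_ideal I N \<and> K \<inter> I = {\<zero>\<^bsub>N\<^esub>} \<and>
     (\<forall>J. nearring_ideal J N \<longrightarrow> K \<inter> J = {\<zero>\<^bsub>N\<^esub>} \<longrightarrow> I \<subseteq> J \<longrightarrow> J = I)"

definition complement_ideal :: "'a set \<Rightarrow> ('a, 'b) ring_scheme \<Rightarrow> bool" where
  "complement_ideal I N \<longleftrightarrow> (\<exists>K. nearring_ideal K N \<and> complement_of I K N)"

definition subnearring :: "'a set \<Rightarrow> ('a, 'b) ring_scheme \<Rightarrow> bool" where
  "subnearring S N \<longleftrightarrow>
     subgroup S (add_monoid N) \<and> (\<forall>a\<in>S. \<forall>b\<in>S. a \<otimes>\<^bsub>N\<^esub> b \<in> S)"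

definition subnearring_generated :: "('a, 'b) ring_scheme \<Rightarrow> 'a set \<Rightarrow> 'a set" where
  "subnearring_generated N H = \<Inter>{S. subnearring S N \<and> H \<subseteq> S}"

text \<open>
  The nearring \<open>M(G)\<close> of all self-maps of a multiplicatively written group \<open>G\<close>. Maps are
  extensional, that is, \<open>undefined\<close> outside \<open>carrier G\<close>.
\<close>

definition maps_nearring :: "('a, 'b) monoid_scheme \<Rightarrow> ('a \<Rightarrow> 'a) ring" where
  "maps_nearring G =
     \<lparr>carrier = carrier G \<rightarrow>\<^sub>E carrier G,
      monoid.mult = (\<lambda>f g. compose (carrier G) f g),
      one = (\<lambda>x\<in>carrier G. x),
      zero = (\<lambda>x\<in>carrier G. \<one>\<^bsub>G\<^esub>),
      add = (\<lambda>f g. \<lambda>x\<in>carrier G. f x \<otimes>\<^bsub>G\<^esub> g x)\<rparr>"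

text \<open>
  Vectors are extensional functions on \<open>{1..n}\<close>. Since this index set is finite, the direct sum
  of \<open>n\<close> copies of the additive group is their direct product.
\<close>

definition vec_group :: "nat \<Rightarrow> ('a, 'b) ring_scheme \<Rightarrow> (nat \<Rightarrow> 'a) monoid" where
  "vec_group n N = product_group {1..n} (\<lambda>_. add_monoid N)"

definition elementary_map ::
  "nat \<Rightarrow> ('a, 'b) ring_scheme \<Rightarrow> nat \<Rightarrow> nat \<Rightarrow> 'a \<Rightarrow> (nat \<Rightarrow> 'a) \<Rightarrow> (nat \<Rightarrow> 'a)" where
  "elementary_map n N i j a =
     (\<lambda>x\<in>carrier (vec_group n N). \<lambda>k\<in>{1..n}. if k = i then a \<otimes>\<^bsub>N\<^esub> x j else \<zero>\<^bsub>N\<^esub>)"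

definition matrix_nearring ::
  "nat \<Rightarrow> ('a, 'b) ring_scheme \<Rightarrow> ((nat \<Rightarrow> 'a) \<Rightarrow> (nat \<Rightarrow> 'a)) ring" where
  "matrix_nearring n N =
     maps_nearring (vec_group n N)
       \<lparr>carrier := subnearring_generated (maps_nearring (vec_group n N))
          {elementary_map n N i j a | i j a. i \<in> {1..n} \<and> j \<in> {1..n} \<and> a \<in> carrier N}\<rparr>"

text \<open>The ideal written \<open>I\<^sup>*\<close> in the literature.\<close>

definition ideal_star ::
  "nat \<Rightarrow> ('a, 'b) ring_scheme \<Rightarrow> 'a set \<Rightarrow> ((nat \<Rightarrow> 'a) \<Rightarrow> (nat \<Rightarrow> 'a)) set" where
  "ideal_star n N I =
     {A \<in> carrier (matrix_nearring n N).
        \<forall>\<rho>\<in>carrier (vec_group n N). A \<rho> \<in> (\<Pi>\<^sub>E k\<in>{1..n}. I)}"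

end

theory Submission
  imports Defs
begin

text \<open>
  Besides \<open>P \<mapsto> P\<^sup>*\<close> consider \<open>J \<mapsto> J\<^sub>* = {x. f\<^sub>1\<^sub>1\<^sup>x \<in> J}\<close>. Matrices commute with the right action of
  \<open>N\<close> on \<open>N\<^sup>n\<close>, so for \<open>A \<in> J\<close> every coordinate of every value \<open>A \<rho>\<close> lies in \<open>J\<^sub>*\<close>. Hence
  \<open>(P\<^sup>*)\<^sub>* = P\<close> and \<open>J \<subseteq> (J\<^sub>*)\<^sup>*\<close>. Both maps are monotone, commute with intersections, and
  preserve and reflect the zero ideal, so \<open>J \<inter> K = 0\<close> if and only if \<open>J\<^sub>* \<inter> K\<^sub>* = 0\<close>; the maximality
  of a complement \<open>Q\<close> therefore forces \<open>Q = (Q\<^sub>*)\<^sup>*\<close>.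
\<close>

section \<open>Nearrings and their ideals\<close>

text \<open>The rewrites give access to the theory of arbitrary, possibly non-abelian, groups in the
  ring notation for sums and negatives.\<close>

sublocale nearring \<subseteq> add: group "add_monoid N"
  rewrites "carrier (add_monoid N) = carrier N"
    and "monoid.mult (add_monoid N) = add N"
    and "one (add_monoid N) = zero N"
    and "m_inv (add_monoid N) = a_inv N"
  by (rule add_group) (simp_all add: a_inv_def fun_eq_iff)

context nearring
begin

lemma minus_closed: "x \<in> carrier N \<Longrightarrow> y \<in> carrier N \<Longrightarrow> x \<ominus> y \<in> carrier N"
  by (simp add: a_minus_def)

lemma l_zero_mult: "c \<in> carrier N \<Longrightarrow> \<zero> \<otimes> c = \<zero>"
  using r_distrib[of \<zero> \<zero> c] m_closed[of \<zero> c] by simp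

lemma l_neg_mult:
  assumes "a \<in> carrier N" "c \<in> carrier N"
  shows "(\<ominus> a) \<otimes> c = \<ominus> (a \<otimes> c)"
proof -
  have "(\<ominus> a) \<otimes> c \<oplus> a \<otimes> c = \<zero>"
    using r_distrib[of "\<ominus> a" a c] assms by (simp add: l_zero_mult)
  then show ?thesis
    using assms by (metis add.inv_equality add.inv_closed m_closed)
qed

lemma nearring_idealD:
  assumes "nearring_ideal I N"
  shows "I \<subseteq> carrier N" "\<zero> \<in> I"
    "\<And>x y. x \<in> I \<Longrightarrow> y \<in> I \<Longrightarrow> x \<oplus> y \<in> I"
    "\<And>x. x \<in> I \<Longrightarrow> \<ominus> x \<in> I"
    "\<And>x y. x \<in> carrier N \<Longrightarrow> y \<in> I \<Longrightarrow> x \<oplus> y \<oplus> \<ominus> x \<in> I"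
    "\<And>x y. x \<in> I \<Longrightarrow> y \<in> carrier N \<Longrightarrow> x \<otimes> y \<in> I"
    "\<And>x y i. x \<in> carrier N \<Longrightarrow> y \<in> carrier N \<Longrightarrow> i \<in> I \<Longrightarrow> x \<otimes> (y \<oplus> i) \<ominus> x \<otimes> y \<in> I"
proof -
  have nI: "I \<lhd> add_monoid N"
    using assms by (simp add: nearring_ideal_def)
  then have sI: "subgroup I (add_monoid N)"
    by (rule normal_imp_subgroup)
  show "I \<subseteq> carrier N" "\<zero> \<in> I" "\<And>x y. x \<in> I \<Longrightarrow> y \<in> I \<Longrightarrow> x \<oplus> y \<in> I"
    using subgroup.subset[OF sI] subgroup.one_closed[OF sI] subgroup.m_closed[OF sI] by simp_all
  show "\<And>x. x \<in> I \<Longrightarrow> \<ominus> x \<in> I"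
    using subgroup.m_inv_closed[OF sI] by (simp add: a_inv_def)
  show "\<And>x y. x \<in> carrier N \<Longrightarrow> y \<in> I \<Longrightarrow> x \<oplus> y \<oplus> \<ominus> x \<in> I"
    using normal.inv_op_closed2[OF nI] by (simp add: a_inv_def)
qed (use assms in \<open>simp_all add: nearring_ideal_def\<close>)

lemma nearring_idealI:
  assumes "I \<subseteq> carrier N" "\<zero> \<in> I"
    "\<And>x y. x \<in> I \<Longrightarrow> y \<in> I \<Longrightarrow> x \<oplus> y \<in> I"
    "\<And>x. x \<in> I \<Longrightarrow> \<ominus> x \<in> I"
    "\<And>x y. x \<in> carrier N \<Longrightarrow> y \<in> I \<Longrightarrow> x \<oplus> y \<oplus> \<ominus> x \<in> I"
    "\<And>x y. x \<in> I \<Longrightarrow> y \<in> carrier N \<Longrightarrow> x \<otimes> y \<in> I"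
    "\<And>x y i. x \<in> carrier N \<Longrightarrow> y \<in> carrier N \<Longrightarrow> i \<in> I \<Longrightarrow> x \<otimes> (y \<oplus> i) \<ominus> x \<otimes> y \<in> I"
  shows "nearring_ideal I N"
proof -
  have "subgroup I (add_monoid N)"
    using assms(1-4) by (auto intro!: add.subgroupI)
  then have "I \<lhd> add_monoid N"
    using assms(5) by (simp add: add.normal_inv_iff)
  then show ?thesis
    using assms(6,7) by (simp add: nearring_ideal_def)
qed

section \<open>Congruence modulo an ideal\<close>

lemma ideal_cong_add:
  assumes I: "nearring_ideal I N"
    and "x \<in> carrier N" "y \<in> carrier N" "x' \<in> carrier N" "y' \<in> carrier N"
    and "x \<ominus> y \<in> I" "x' \<ominus> y' \<in> I"
  shows "(x \<oplus> x') \<ominus> (y \<oplus> y') \<in> I"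
proof -
  have "\<ominus> x \<oplus> (x \<oplus> \<ominus> y) = \<ominus> y"
    using assms(2,3) by (simp flip: add.m_assoc)
  \<comment> \<open>Addition need not commute, so the difference \<open>x' \<ominus> y'\<close>
    appears conjugated by \<open>x\<close>; normality keeps this conjugate in
    \<open>I\<close>.\<close>
  then have "(x \<oplus> x') \<ominus> (y \<oplus> y') = (x \<oplus> (x' \<ominus> y') \<oplus> \<ominus> x) \<oplus> (x \<ominus> y)"
    using assms(2-5) by (simp add: a_minus_def add.m_assoc add.inv_mult_group)
  then show ?thesis
    using nearring_idealD(3,5)[OF I] assms by simp
qed

lemma ideal_cong_neg:
  assumes I: "nearring_ideal I N" and "x \<in> carrier N" "y \<in> carrier N" "x \<ominus> y \<in> I"
  shows "(\<ominus> x) \<ominus> (\<ominus> y) \<in> I"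
proof -
  \<comment> \<open>The difference is the conjugate by \<open>\<ominus> x\<close> of the negative of
    \<open>x \<ominus> y\<close>.\<close>
  have "(\<ominus> x) \<ominus> (\<ominus> y) = \<ominus> x \<oplus> \<ominus> (x \<ominus> y) \<oplus> \<ominus> (\<ominus> x)"
    using assms(2,3) by (simp add: a_minus_def add.m_assoc add.inv_mult_group)
  then show ?thesis
    using nearring_idealD(4)[OF I assms(4)] nearring_idealD(5)[OF I, of "\<ominus> x"] assms(2) by simp
qed

text \<open>The ideal axiom treats a summand from \<open>I\<close> added on the right, whereas
  \<open>x \<ominus> y\<close> is the summand to be added to \<open>y\<close> on the left.
  Conjugation by \<open>\<ominus> y\<close> turns it into \<open>\<ominus> y \<oplus> x\<close>, and
  \<open>x = y \<oplus> (\<ominus> y \<oplus> x)\<close>.\<close>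

lemma ideal_cong_mult_left:
  assumes I: "nearring_ideal I N"
    and "a \<in> carrier N" "x \<in> carrier N" "y \<in> carrier N" "x \<ominus> y \<in> I"
  shows "a \<otimes> x \<ominus> a \<otimes> y \<in> I"
proof -
  have "\<ominus> y \<oplus> (x \<ominus> y) \<oplus> \<ominus> (\<ominus> y) \<in> I"
    using nearring_idealD(5)[OF I, of "\<ominus> y"] assms by simp
  moreover have "\<ominus> y \<oplus> (x \<ominus> y) \<oplus> \<ominus> (\<ominus> y) = \<ominus> y \<oplus> x"
    using assms(3,4) by (simp add: a_minus_def add.m_assoc)
  moreover have "y \<oplus> (\<ominus> y \<oplus> x) = x"
    using assms(3,4) by (simp flip: add.m_assoc)
  ultimately show ?thesis
    using nearring_idealD(7)[OF I, of a y "\<ominus> y \<oplus> x"] assms by simp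
qed

section \<open>Subnearrings\<close>

lemma subnearring_carrier: "subnearring (carrier N) N"
  using add.subgroup_self m_closed by (simp add: subnearring_def)

lemma subnearring_subnearring_generated:
  assumes "H \<subseteq> carrier N"
  shows "subnearring (subnearring_generated N H) N"
proof -
  let ?F = "{S. subnearring S N \<and> H \<subseteq> S}"
  have "?F \<noteq> {}"
    using subnearring_carrier assms by blast
  then have "subgroup (\<Inter>?F) (add_monoid N)"
    by (intro add.subgroups_Inter) (auto simp: subnearring_def)
  then show ?thesis
    by (auto simp: subnearring_generated_def subnearring_def)
qed

lemma nearring_subnearring:
  assumes "subnearring S N"
  shows "nearring (N\<lparr>carrier := S\<rparr>)"
proof -
  have S: "subgroup S (add_monoid N)"
    using assms by (simp add: subnearring_def)
  then have sub: "S \<subseteq> carrier N"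
    using subgroup.subset by fastforce
  have "group (add_monoid (N\<lparr>carrier := S\<rparr>))"
    using subgroup.subgroup_is_group[OF S add_group] by simp
  with sub show ?thesis
    using assms unfolding nearring_def subnearring_def
    by (auto intro: m_assoc r_distrib)
qed

text \<open>Negation, unlike addition and multiplication, is defined by a choice within the carrier;
  uniqueness of inverses makes the two choices agree on \<open>S\<close>.\<close>

lemma a_inv_subnearring:
  assumes "subnearring S N" "x \<in> S"
  shows "\<ominus>\<^bsub>N\<lparr>carrier := S\<rparr>\<^esub> x = \<ominus> x"
  using group.m_inv_consistent[OF add_group, of S x] assms
  by (simp add: subnearring_def a_inv_def)

end

lemma nearring_maps_nearring:
  assumes "group G"
  shows "nearring (maps_nearring G)"
proof (rule nearring.intro)
  interpret G: group G by fact
  \<comment> \<open>Pointwise addition of self-maps is the direct power of \<open>G\<close> indexed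
    by its own carrier.\<close>
  have "add_monoid (maps_nearring G) = product_group (carrier G) (\<lambda>_. G)"
    by (simp add: maps_nearring_def product_group_def)
  then show "group (add_monoid (maps_nearring G))"
    by (simp add: assms)
qed (auto simp: maps_nearring_def compose_def fun_eq_iff intro: assms group.is_monoid monoid.m_closed)

section \<open>The matrix nearring\<close>

locale matrix_nearring_context = nearring N + mult: monoid N
  for N :: "('a, 'b) ring_scheme" (structure) +
  fixes n :: nat
  assumes n_pos: "n \<ge> 1"
begin

abbreviation M where "M \<equiv> matrix_nearring n N"

definition V where "V = carrier (vec_group n N)"

abbreviation E where "E \<equiv> elementary_map n N"

declare One_nat_def [simp del] atLeastAtMost_iff [simp del]

lemma one_index [simp]: "1 \<in> {1..n}"
  using n_pos by (simp add: atLeastAtMost_iff)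

lemma V_eq: "V = ({1..n} \<rightarrow>\<^sub>E carrier N)"
  by (simp add: V_def vec_group_def)

lemma vec_coord: "v \<in> V \<Longrightarrow> k \<in> {1..n} \<Longrightarrow> v k \<in> carrier N"
  by (auto simp: V_eq)

lemma vec_eqI:
  assumes "v \<in> V" "w \<in> V" "\<And>k. k \<in> {1..n} \<Longrightarrow> v k = w k"
  shows "v = w"
  using assms unfolding V_eq by (rule PiE_ext)

lemma restrict_in_V: "(\<And>k. k \<in> {1..n} \<Longrightarrow> f k \<in> carrier N) \<Longrightarrow> restrict f {1..n} \<in> V"
  by (auto simp: V_eq)

lemma group_vec_group: "group (vec_group n N)"
  by (simp add: vec_group_def add_group)

lemma elementary_map_in_maps:
  assumes "j \<in> {1..n}" "a \<in> carrier N"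
  shows "E i j a \<in> carrier (maps_nearring (vec_group n N))"
  using assms
  by (auto simp: maps_nearring_def elementary_map_def vec_coord m_closed restrict_in_V
      simp flip: V_def)

interpretation maps: nearring "maps_nearring (vec_group n N)"
  by (rule nearring_maps_nearring[OF group_vec_group])

lemma subnearring_matrix: "subnearring (carrier M) (maps_nearring (vec_group n N))"
  unfolding matrix_nearring_def
  using elementary_map_in_maps by (auto intro!: maps.subnearring_subnearring_generated)

lemma nearring_matrix: "nearring M"
  using maps.nearring_subnearring[OF subnearring_matrix] by (simp add: matrix_nearring_def)

sublocale M: nearring M
  by (rule nearring_matrix)

lemma elementary_map_closed:
  "i \<in> {1..n} \<Longrightarrow> j \<in> {1..n} \<Longrightarrow> a \<in> carrier N \<Longrightarrow> E i j a \<in> carrier M"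
  by (auto simp: matrix_nearring_def subnearring_generated_def)

lemma matrix_in_maps: "A \<in> carrier M \<Longrightarrow> A \<in> V \<rightarrow>\<^sub>E V"
  using subgroup.subset[of "carrier M"] subnearring_matrix
  by (fastforce simp: subnearring_def maps_nearring_def V_def[symmetric])

lemma apply_closed: "A \<in> carrier M \<Longrightarrow> v \<in> V \<Longrightarrow> A v \<in> V"
  using matrix_in_maps by blast

lemma coord_closed: "A \<in> carrier M \<Longrightarrow> v \<in> V \<Longrightarrow> k \<in> {1..n} \<Longrightarrow> A v k \<in> carrier N"
  by (rule vec_coord[OF apply_closed])

lemma matrix_eqI:
  assumes "A \<in> carrier M" "B \<in> carrier M"
    and "\<And>v k. v \<in> V \<Longrightarrow> k \<in> {1..n} \<Longrightarrow> A v k = B v k"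
  shows "A = B"
  using matrix_in_maps[OF assms(1)] matrix_in_maps[OF assms(2)]
  by (rule PiE_ext) (rule vec_eqI[OF apply_closed[OF assms(1)] apply_closed[OF assms(2)] assms(3)])

section \<open>Coordinates of matrix operations\<close>

lemma elementary_apply:
  "v \<in> V \<Longrightarrow> k \<in> {1..n} \<Longrightarrow> E i j a v k = (if k = i then a \<otimes> v j else \<zero>)"
  by (simp add: elementary_map_def V_def[symmetric])

lemma add_apply:
  "v \<in> V \<Longrightarrow> k \<in> {1..n} \<Longrightarrow> (A \<oplus>\<^bsub>M\<^esub> B) v k = A v k \<oplus> B v k"
  by (simp add: matrix_nearring_def maps_nearring_def V_def[symmetric])
    (simp add: vec_group_def)

lemma mult_apply: "v \<in> V \<Longrightarrow> (A \<otimes>\<^bsub>M\<^esub> B) v = A (B v)"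
  by (simp add: matrix_nearring_def maps_nearring_def V_def[symmetric] compose_def)

lemma zero_apply: "v \<in> V \<Longrightarrow> k \<in> {1..n} \<Longrightarrow> \<zero>\<^bsub>M\<^esub> v k = \<zero>"
  by (simp add: matrix_nearring_def maps_nearring_def V_def[symmetric])
    (simp add: vec_group_def)

text \<open>Evaluating \<open>\<ominus> A \<oplus> A = \<zero>\<close> at each coordinate identifies
  the negative, by uniqueness of inverses in \<open>N\<close>.\<close>

lemma neg_apply:
  assumes "A \<in> carrier M" "v \<in> V" "k \<in> {1..n}"
  shows "(\<ominus>\<^bsub>M\<^esub> A) v k = \<ominus> (A v k)"
proof -
  have "((\<ominus>\<^bsub>M\<^esub> A) \<oplus>\<^bsub>M\<^esub> A) v k = \<zero>"
    using assms(2,3) M.add.l_inv[OF assms(1)] by (simp add: zero_apply)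
  then have "(\<ominus>\<^bsub>M\<^esub> A) v k \<oplus> A v k = \<zero>"
    using assms(2,3) by (simp add: add_apply)
  then show ?thesis
    using assms coord_closed by (metis add.inv_equality M.add.inv_closed)
qed

lemma minus_apply:
  "A \<in> carrier M \<Longrightarrow> B \<in> carrier M \<Longrightarrow> v \<in> V \<Longrightarrow> k \<in> {1..n} \<Longrightarrow> (A \<ominus>\<^bsub>M\<^esub> B) v k = A v k \<ominus> B v k"
  by (simp add: a_minus_def add_apply neg_apply)

text \<open>The matrices satisfying \<open>P\<close> form a subnearring of all self-maps that
  contains the generators, hence contain the intersection of all such subnearrings.\<close>

lemma matrix_induct [consumes 1, case_names elementary add neg mult]:
  assumes "A \<in> carrier M"
    and elem: "\<And>i j a. i \<in> {1..n} \<Longrightarrow> j \<in> {1..n} \<Longrightarrow> a \<in> carrier N \<Longrightarrow> P (E i j a)"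
    and add: "\<And>A B. A \<in> carrier M \<Longrightarrow> B \<in> carrier M \<Longrightarrow> P A \<Longrightarrow> P B \<Longrightarrow> P (A \<oplus>\<^bsub>M\<^esub> B)"
    and neg: "\<And>A. A \<in> carrier M \<Longrightarrow> P A \<Longrightarrow> P (\<ominus>\<^bsub>M\<^esub> A)"
    and mult: "\<And>A B. A \<in> carrier M \<Longrightarrow> B \<in> carrier M \<Longrightarrow> P A \<Longrightarrow> P B \<Longrightarrow> P (A \<otimes>\<^bsub>M\<^esub> B)"
  shows "P A"
proof -
  let ?R = "maps_nearring (vec_group n N)"
  let ?S = "{A \<in> carrier M. P A}"
  have M: "M = ?R\<lparr>carrier := carrier M\<rparr>"
    by (simp add: matrix_nearring_def)
  have ops: "add M = add ?R" "monoid.mult M = monoid.mult ?R"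
    by (simp_all add: matrix_nearring_def)
  have neg_eq: "\<ominus>\<^bsub>M\<^esub> A = \<ominus>\<^bsub>?R\<^esub> A" if "A \<in> carrier M" for A
    using maps.a_inv_subnearring[OF subnearring_matrix that] M by simp
  \<comment> \<open>One generator suffices to make \<open>?S\<close> nonempty, as the subgroup
    criterion demands.\<close>
  have "E 1 1 \<zero> \<in> ?S"
    using elem elementary_map_closed by simp
  moreover have "?S \<subseteq> carrier ?R"
    using subnearring_matrix subgroup.subset by (fastforce simp: subnearring_def)
  ultimately have "subgroup ?S (add_monoid ?R)"
    using add neg neg_eq M.add.inv_closed M.add.m_closed
    by (intro maps.add.subgroupI) (auto simp: ops)
  then have "subnearring ?S ?R"
    using mult M.m_closed by (auto simp: subnearring_def ops)
  moreover have "{E i j a | i j a. i \<in> {1..n} \<and> j \<in> {1..n} \<and> a \<in> carrier N} \<subseteq> ?S"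
    using elem elementary_map_closed by blast
  ultimately have "carrier M \<subseteq> ?S"
    by (subst matrix_nearring_def) (auto simp: subnearring_generated_def)
  with assms(1) show ?thesis by blast
qed

section \<open>The right action of \<open>N\<close> on vectors\<close>

definition scale :: "(nat \<Rightarrow> 'a) \<Rightarrow> 'a \<Rightarrow> nat \<Rightarrow> 'a" where
  "scale v s = (\<lambda>k\<in>{1..n}. v k \<otimes> s)"

lemma scale_closed: "v \<in> V \<Longrightarrow> s \<in> carrier N \<Longrightarrow> scale v s \<in> V"
  by (simp add: scale_def restrict_in_V vec_coord m_closed)

lemma scale_apply: "k \<in> {1..n} \<Longrightarrow> scale v s k = v k \<otimes> s"
  by (simp add: scale_def)

text \<open>On generators this is associativity, together with
  \<open>\<zero> \<otimes> s = \<zero>\<close> in the other rows. Right distributivity passes it to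
  sums and negatives; for products the vector must vary in the induction.\<close>

lemma apply_scale:
  assumes "A \<in> carrier M" "v \<in> V" "s \<in> carrier N"
  shows "A (scale v s) = scale (A v) s"
  using assms(1,2)
proof (induction arbitrary: v rule: matrix_induct)
  case (mult A B)
  then show ?case
    using scale_closed[of v s] apply_closed[of B v] assms(3) by (simp add: mult_apply)
next
  case (elementary i j a)
  then have "E i j a \<in> carrier M"
    by (simp add: elementary_map_closed)
  with elementary assms(3) show ?case
    by (intro vec_eqI)
      (simp_all add: scale_apply elementary_apply vec_coord m_assoc l_zero_mult scale_closed
        apply_closed)
next
  case (add A B)
  then have "A \<oplus>\<^bsub>M\<^esub> B \<in> carrier M"
    by simp
  with add assms(3) show ?case
    by (intro vec_eqI)
      (simp_all add: scale_apply add_apply r_distrib scale_closed apply_closed coord_closed)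
next
  case (neg A)
  then have "\<ominus>\<^bsub>M\<^esub> A \<in> carrier M"
    by simp
  with neg assms(3) show ?case
    by (intro vec_eqI)
      (simp_all add: scale_apply neg_apply l_neg_mult scale_closed apply_closed coord_closed)
qed

text \<open>Matrices need not be additive, but they respect congruence modulo \<open>I\<close> in
  every coordinate: generators do so by the left-hand ideal axiom, and sums, negatives and
  compositions inherit it. This supplies the same axiom for \<open>star I\<close>.\<close>

lemma apply_cong:
  assumes I: "nearring_ideal I N"
    and "A \<in> carrier M" "v \<in> V" "w \<in> V"
    and "\<And>k. k \<in> {1..n} \<Longrightarrow> v k \<ominus> w k \<in> I"
    and "k \<in> {1..n}"
  shows "A v k \<ominus> A w k \<in> I"
  using assms(2-)
proof (induction arbitrary: v w k rule: matrix_induct)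
  case (elementary i j a)
  then have "v j \<in> carrier N" "w j \<in> carrier N" by (simp_all add: vec_coord)
  with elementary show ?case
    using ideal_cong_mult_left[OF I] nearring_idealD(2)[OF I]
    by (simp add: elementary_apply a_minus_def)
next
  case (add A B)
  then show ?case
    using ideal_cong_add[OF I] coord_closed by (simp add: add_apply)
next
  case (neg A)
  then show ?case
    using ideal_cong_neg[OF I] coord_closed by (simp add: neg_apply)
next
  case (mult A B)
  show ?case
    using mult.IH(1)[OF apply_closed apply_closed] mult by (simp add: mult_apply)
qed

text \<open>The map is the sum of the \<open>E k 1 (v k)\<close> over all rows \<open>k\<close>, a
  matrix whose first column is \<open>v\<close> and whose other columns vanish.\<close>

lemma column_closed:
  assumes v: "v \<in> V"
  shows "(\<lambda>w\<in>V. scale v (w 1)) \<in> carrier M"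
proof -
  \<comment> \<open>The partial sum over the rows up to \<open>m\<close>; \<open>m = 0\<close> gives
    the zero matrix since indices start at 1.\<close>
  let ?B = "\<lambda>m. \<lambda>w\<in>V. \<lambda>k\<in>{1..n}. if k \<le> m then v k \<otimes> w 1 else \<zero>"
  have B_maps: "?B m \<in> V \<rightarrow>\<^sub>E V" for m
    using v by (intro restrict_PiE_iff[THEN iffD2] ballI restrict_in_V)
      (simp add: m_closed vec_coord)
  have eqI: "?B m = C"
    if C: "C \<in> carrier M" and eq: "\<And>w k. w \<in> V \<Longrightarrow> k \<in> {1..n} \<Longrightarrow> ?B m w k = C w k" for m C
    using B_maps matrix_in_maps[OF C]
    by (rule PiE_ext) (rule vec_eqI[OF PiE_mem[OF B_maps] apply_closed[OF C] eq])
  have B_closed: "?B m \<in> carrier M" if "m \<le> n" for m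
    using that
  proof (induction m)
    case 0
    have "?B 0 = \<zero>\<^bsub>M\<^esub>"
      by (rule eqI[OF M.add.one_closed]) (simp add: zero_apply, simp add: atLeastAtMost_iff)
    then show ?case
      using M.add.one_closed by (simp only:)
  next
    case (Suc m)
    then have "Suc m \<in> {1..n}"
      by (simp add: atLeastAtMost_iff One_nat_def)
    then have E: "E (Suc m) 1 (v (Suc m)) \<in> carrier M"
      using v by (simp add: elementary_map_closed vec_coord)
    let ?C = "?B m \<oplus>\<^bsub>M\<^esub> E (Suc m) 1 (v (Suc m))"
    have C: "?C \<in> carrier M"
      by (intro M.add.m_closed E Suc.IH) (use Suc.prems in simp)
    \<comment> \<open>In every coordinate at least one of the two summands is zero, so the order of
      addition does not matter.\<close>
    have "?B (Suc m) = ?C"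
      by (rule eqI[OF C])
        (auto simp: add_apply elementary_apply le_Suc_eq v vec_coord m_closed)
    with C show ?case by (simp only:)
  qed
  have "?B n = (\<lambda>w\<in>V. scale v (w 1))"
    unfolding scale_def by (intro restrict_ext) (simp add: atLeastAtMost_iff)
  with B_closed[of n] show ?thesis by simp
qed

section \<open>The two maps between ideals\<close>

abbreviation star where "star \<equiv> ideal_star n N"

definition unstar :: "((nat \<Rightarrow> 'a) \<Rightarrow> (nat \<Rightarrow> 'a)) set \<Rightarrow> 'a set" where
  "unstar J = {x \<in> carrier N. E 1 1 x \<in> J}"

text \<open>Values of matrices are already extensional vectors, so membership in the product reduces
  to a condition on coordinates.\<close>

lemma mem_star_iff:
  "A \<in> star I \<longleftrightarrow> A \<in> carrier M \<and> (\<forall>v\<in>V. \<forall>k\<in>{1..n}. A v k \<in> I)"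
  using apply_closed by (auto simp: ideal_star_def V_def[symmetric] V_eq PiE_iff)

lemma star_mono: "I \<subseteq> I' \<Longrightarrow> star I \<subseteq> star I'"
  unfolding mem_star_iff subset_iff by blast

lemma unstar_mono: "J \<subseteq> J' \<Longrightarrow> unstar J \<subseteq> unstar J'"
  by (auto simp: unstar_def)

lemma star_Int: "star (I \<inter> I') = star I \<inter> star I'"
  by (auto simp: mem_star_iff)

lemma star_zero: "star {\<zero>} = {\<zero>\<^bsub>M\<^esub>}"
proof
  show "star {\<zero>} \<subseteq> {\<zero>\<^bsub>M\<^esub>}"
    by (auto simp: mem_star_iff zero_apply intro!: matrix_eqI)
qed (auto simp: mem_star_iff zero_apply)

section \<open>The embedding of \<open>N\<close> into the matrix nearring at position (1,1)\<close>

lemma elementary_add: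
  assumes "x \<in> carrier N" "y \<in> carrier N"
  shows "E 1 1 (x \<oplus> y) = E 1 1 x \<oplus>\<^bsub>M\<^esub> E 1 1 y"
proof (rule matrix_eqI)
  fix v k assume "v \<in> V" "k \<in> {1..n}"
  moreover from this have "v 1 \<in> carrier N" by (simp add: vec_coord)
  ultimately show "E 1 1 (x \<oplus> y) v k = (E 1 1 x \<oplus>\<^bsub>M\<^esub> E 1 1 y) v k"
    using assms by (simp add: add_apply elementary_apply r_distrib)
qed (use assms in \<open>simp_all add: elementary_map_closed\<close>)

lemma elementary_neg:
  assumes "x \<in> carrier N"
  shows "E 1 1 (\<ominus> x) = \<ominus>\<^bsub>M\<^esub> E 1 1 x"
proof (rule matrix_eqI)
  fix v k assume "v \<in> V" "k \<in> {1..n}"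
  moreover from this have "v 1 \<in> carrier N" by (simp add: vec_coord)
  ultimately show "E 1 1 (\<ominus> x) v k = (\<ominus>\<^bsub>M\<^esub> E 1 1 x) v k"
    using assms by (simp add: neg_apply elementary_apply elementary_map_closed l_neg_mult)
qed (use assms in \<open>simp_all add: elementary_map_closed\<close>)

lemma elementary_mult:
  assumes "x \<in> carrier N" "y \<in> carrier N"
  shows "E 1 1 (x \<otimes> y) = E 1 1 x \<otimes>\<^bsub>M\<^esub> E 1 1 y"
proof (rule matrix_eqI)
  fix v k assume "v \<in> V" "k \<in> {1..n}"
  moreover from this have "v 1 \<in> carrier N" by (simp add: vec_coord)
  moreover from calculation assms have "E 1 1 y v \<in> V"
    by (intro apply_closed[OF elementary_map_closed]) simp_all
  ultimately show "E 1 1 (x \<otimes> y) v k = (E 1 1 x \<otimes>\<^bsub>M\<^esub> E 1 1 y) v k"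
    using assms by (simp add: mult_apply elementary_apply m_assoc)
qed (use assms in \<open>simp_all add: elementary_map_closed m_closed M.m_closed\<close>)

lemma elementary_zero: "E 1 1 \<zero> = \<zero>\<^bsub>M\<^esub>"
proof (rule matrix_eqI)
  fix v k assume "v \<in> V" "k \<in> {1..n}"
  moreover from this have "v 1 \<in> carrier N" by (simp add: vec_coord)
  ultimately show "E 1 1 \<zero> v k = \<zero>\<^bsub>M\<^esub> v k"
    by (simp add: zero_apply elementary_apply l_zero_mult)
qed (simp_all add: elementary_map_closed)

lemma elementary_inject:
  assumes "x \<in> carrier N" "y \<in> carrier N" "E 1 1 x = E 1 1 y"
  shows "x = y"
proof -
  \<comment> \<open>The all-ones vector recovers \<open>z\<close> from \<open>E 1 1 z\<close>,
    because \<open>z \<otimes> \<one> = z\<close>.\<close>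
  let ?u = "\<lambda>k\<in>{1..n}. \<one>"
  have u: "?u \<in> V" by (simp add: restrict_in_V)
  have "E 1 1 z ?u 1 = z" if "z \<in> carrier N" for z
    using that by (simp add: elementary_apply[OF u])
  then show ?thesis
    using assms by metis
qed

lemma unstar_zero: "unstar {\<zero>\<^bsub>M\<^esub>} = {\<zero>}"
proof
  show "unstar {\<zero>\<^bsub>M\<^esub>} \<subseteq> {\<zero>}"
    using elementary_inject[OF _ add.one_closed] unfolding unstar_def elementary_zero by blast
qed (simp add: unstar_def elementary_zero)

lemma nearring_ideal_star:
  assumes I: "nearring_ideal I N"
  shows "nearring_ideal (star I) M"
proof (rule M.nearring_idealI)
  note D = nearring_idealD[OF I]
  show "star I \<subseteq> carrier M"
    by (auto simp: mem_star_iff)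
  show "\<zero>\<^bsub>M\<^esub> \<in> star I"
    using D by (simp add: mem_star_iff zero_apply)
  show "A \<oplus>\<^bsub>M\<^esub> B \<in> star I" if "A \<in> star I" "B \<in> star I" for A B
    using that D by (simp add: mem_star_iff add_apply)
  show "\<ominus>\<^bsub>M\<^esub> A \<in> star I" if "A \<in> star I" for A
    using that D by (simp add: mem_star_iff neg_apply)
  show "A \<oplus>\<^bsub>M\<^esub> B \<oplus>\<^bsub>M\<^esub> \<ominus>\<^bsub>M\<^esub> A \<in> star I" if "A \<in> carrier M" "B \<in> star I" for A B
    using that D coord_closed by (simp add: mem_star_iff add_apply neg_apply)
  show "A \<otimes>\<^bsub>M\<^esub> B \<in> star I" if "A \<in> star I" "B \<in> carrier M" for A B
    using that apply_closed by (simp add: mem_star_iff mult_apply M.m_closed)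
  show "A \<otimes>\<^bsub>M\<^esub> (B \<oplus>\<^bsub>M\<^esub> C) \<ominus>\<^bsub>M\<^esub> A \<otimes>\<^bsub>M\<^esub> B \<in> star I"
    if A: "A \<in> carrier M" and B: "B \<in> carrier M" and "C \<in> star I" for A B C
  proof -
    from \<open>C \<in> star I\<close> have C: "C \<in> carrier M" by (simp add: mem_star_iff)
    have BC: "B \<oplus>\<^bsub>M\<^esub> C \<in> carrier M"
      using B C by simp
    \<comment> \<open>The vectors \<open>(B + C) v\<close> and \<open>B v\<close> are congruent
      modulo \<open>I\<close>: in each coordinate their difference is a conjugate of an entry of
      \<open>C v\<close>. The matrix \<open>A\<close> preserves the congruence.\<close>
    have "A ((B \<oplus>\<^bsub>M\<^esub> C) v) k \<ominus> A (B v) k \<in> I" if v: "v \<in> V" and k: "k \<in> {1..n}" for v k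
    proof (rule apply_cong[OF I A apply_closed[OF BC v] apply_closed[OF B v] _ k])
      fix l assume l: "l \<in> {1..n}"
      then have "C v l \<in> I"
        using \<open>C \<in> star I\<close> v by (simp add: mem_star_iff)
      then show "(B \<oplus>\<^bsub>M\<^esub> C) v l \<ominus> B v l \<in> I"
        using D(5) coord_closed[OF B v l] v l by (simp add: add_apply a_minus_def)
    qed
    then show ?thesis
      using A B C BC
      by (simp add: mem_star_iff minus_apply mult_apply M.minus_closed M.m_closed)
  qed
qed

text \<open>\<open>unstar J\<close> is the preimage of \<open>J\<close> under the homomorphism
  \<open>E 1 1\<close>, so each axiom is that of \<open>J\<close> at matrices in the image.\<close>

lemma nearring_ideal_unstar:
  assumes J: "nearring_ideal J M"
  shows "nearring_ideal (unstar J) N"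
proof (rule nearring_idealI)
  note D = M.nearring_idealD[OF J]
  have closed: "E 1 1 x \<in> carrier M" if "x \<in> carrier N" for x
    using that by (simp add: elementary_map_closed)
  note hom = elementary_add elementary_neg elementary_mult elementary_zero
  show "unstar J \<subseteq> carrier N"
    by (auto simp: unstar_def)
  show "\<zero> \<in> unstar J"
    using D(2) hom(4) by (simp add: unstar_def)
  show "x \<oplus> y \<in> unstar J" if "x \<in> unstar J" "y \<in> unstar J" for x y
    using that D(3) hom(1)[of x y] by (simp add: unstar_def)
  show "\<ominus> x \<in> unstar J" if "x \<in> unstar J" for x
    using that D(4) hom(2)[of x] by (simp add: unstar_def)
  show "x \<oplus> y \<oplus> \<ominus> x \<in> unstar J" if "x \<in> carrier N" "y \<in> unstar J" for x y
    using that D(5)[OF closed, of x "E 1 1 y"] hom(1)[of "x \<oplus> y" "\<ominus> x"] hom(1)[of x y] hom(2)[of x]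
    by (simp add: unstar_def)
  show "x \<otimes> y \<in> unstar J" if "x \<in> unstar J" "y \<in> carrier N" for x y
    using that D(6)[OF _ closed, of "E 1 1 x" y] hom(3)[of x y]
    by (simp add: unstar_def m_closed)
  show "x \<otimes> (y \<oplus> i) \<ominus> x \<otimes> y \<in> unstar J"
    if "x \<in> carrier N" "y \<in> carrier N" "i \<in> unstar J" for x y i
    using that D(7)[OF closed closed, of x y "E 1 1 i"]
    by (simp add: unstar_def a_minus_def m_closed hom)
qed

text \<open>One inclusion evaluates \<open>E 1 1 x\<close> at the all-ones vector; the other holds
  since every entry \<open>x \<otimes> v 1\<close> or \<open>\<zero>\<close> lies in
  \<open>I\<close>.\<close>

lemma unstar_star:
  assumes I: "nearring_ideal I N"
  shows "unstar (star I) = I"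
proof
  show "unstar (star I) \<subseteq> I"
  proof
    fix x assume "x \<in> unstar (star I)"
    then have x: "x \<in> carrier N" and "E 1 1 x \<in> star I"
      by (auto simp: unstar_def)
    moreover have v: "(\<lambda>k\<in>{1..n}. \<one>) \<in> V" by (simp add: restrict_in_V)
    ultimately have "E 1 1 x (\<lambda>k\<in>{1..n}. \<one>) 1 \<in> I"
      by (simp add: mem_star_iff)
    then show "x \<in> I"
      using elementary_apply[OF v, of 1 1 1 x] x by simp
  qed
next
  note D = nearring_idealD[OF I]
  show "I \<subseteq> unstar (star I)"
  proof
    fix x assume x: "x \<in> I"
    then have "x \<in> carrier N" using D(1) by blast
    moreover have "v 1 \<in> carrier N" if "v \<in> V" for v
      using that by (simp add: vec_coord)
    ultimately show "x \<in> unstar (star I)"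
      using D(2,6) x
      by (simp add: unstar_def mem_star_iff elementary_apply elementary_map_closed)
  qed
qed

text \<open>
  Composing \<open>A\<close> on the right with the matrix that sends \<open>w\<close> to \<open>v w\<^sub>1\<close> and on the left with
  \<open>f\<^sub>1\<^sub>k\<^sup>1\<close> gives \<open>f\<^sub>1\<^sub>1\<^sup>x\<close> for \<open>x = (A v)\<^sub>k\<close>. The left composition stays in \<open>J\<close> even though \<open>N\<close> need not
  be zero-symmetric, because \<open>f\<^sub>1\<^sub>k\<^sup>1\<close> maps \<open>0\<close> to \<open>0\<close>.
\<close>

lemma coord_in_unstar:
  assumes J: "nearring_ideal J M" and A: "A \<in> J" and v: "v \<in> V" and k: "k \<in> {1..n}"
  shows "A v k \<in> unstar J"
proof -
  note D = M.nearring_idealD[OF J]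
  have AM: "A \<in> carrier M"
    using A D(1) by blast
  let ?B = "\<lambda>w\<in>V. scale v (w 1)"
  let ?F = "E 1 k \<one>"
  have B: "?B \<in> carrier M"
    using v by (rule column_closed)
  have F: "?F \<in> carrier M"
    using k by (simp add: elementary_map_closed)
  have AB: "A \<otimes>\<^bsub>M\<^esub> ?B \<in> J"
    using A B by (rule D(6))
  then have ABM: "A \<otimes>\<^bsub>M\<^esub> ?B \<in> carrier M"
    using D(1) by blast
  have "?F \<otimes>\<^bsub>M\<^esub> \<zero>\<^bsub>M\<^esub> = \<zero>\<^bsub>M\<^esub>"
  proof (rule matrix_eqI)
    fix w l assume "w \<in> V" "l \<in> {1..n}"
    then show "(?F \<otimes>\<^bsub>M\<^esub> \<zero>\<^bsub>M\<^esub>) w l = \<zero>\<^bsub>M\<^esub> w l"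
      using k apply_closed[OF M.add.one_closed, of w]
      by (simp add: mult_apply elementary_apply zero_apply)
  qed (use F in \<open>simp_all add: M.m_closed\<close>)
  then have "?F \<otimes>\<^bsub>M\<^esub> (A \<otimes>\<^bsub>M\<^esub> ?B) \<in> J"
    using D(7)[OF F M.add.one_closed AB] F ABM by (simp add: a_minus_def M.m_closed)
  also have "?F \<otimes>\<^bsub>M\<^esub> (A \<otimes>\<^bsub>M\<^esub> ?B) = E 1 1 (A v k)"
  proof (rule matrix_eqI)
    show "?F \<otimes>\<^bsub>M\<^esub> (A \<otimes>\<^bsub>M\<^esub> ?B) \<in> carrier M"
      using F ABM by (rule M.m_closed)
    show "E 1 1 (A v k) \<in> carrier M"
      using coord_closed[OF AM v k] by (simp add: elementary_map_closed)
    fix w l assume w: "w \<in> V" and l: "l \<in> {1..n}"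
    have w1: "w 1 \<in> carrier N"
      using w by (simp add: vec_coord)
    \<comment> \<open>Here the commutation of \<open>A\<close> with the right action moves the
      factor \<open>w 1\<close> outside.\<close>
    have "(A \<otimes>\<^bsub>M\<^esub> ?B) w = A (scale v (w 1))"
      using w by (simp add: mult_apply)
    also have "\<dots> = scale (A v) (w 1)"
      using AM v w1 by (rule apply_scale)
    finally have *: "(A \<otimes>\<^bsub>M\<^esub> ?B) w k = A v k \<otimes> w 1"
      using k by (simp add: scale_apply)
    show "(?F \<otimes>\<^bsub>M\<^esub> (A \<otimes>\<^bsub>M\<^esub> ?B)) w l = E 1 1 (A v k) w l"
      unfolding mult_apply[OF w, of ?F] elementary_apply[OF w l]
        elementary_apply[OF apply_closed[OF ABM w] l] *
      using coord_closed[OF AM v k] w1 by (simp add: m_closed)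
  qed
  finally show ?thesis
    using coord_closed[OF AM v k] by (simp add: unstar_def)
qed

lemma subset_star_unstar:
  assumes J: "nearring_ideal J M"
  shows "J \<subseteq> star (unstar J)"
  using coord_in_unstar[OF J] M.nearring_idealD(1)[OF J] by (auto simp: mem_star_iff)

section \<open>Complements under the two maps\<close>

lemma unstar_Int_eq_zero:
  assumes "J \<inter> K = {\<zero>\<^bsub>M\<^esub>}"
  shows "unstar J \<inter> unstar K = {\<zero>}"
proof -
  have "unstar J \<inter> unstar K = unstar (J \<inter> K)"
    by (auto simp: unstar_def)
  with assms show ?thesis by (simp add: unstar_zero)
qed

text \<open>The inclusion of \<open>K\<close> in \<open>star (unstar K)\<close> is enough: it places
  the intersection inside \<open>star {\<zero>}\<close>, and both ideals contain zero.\<close>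

lemma star_Int_eq_zero:
  assumes "nearring_ideal K M" "nearring_ideal I N" "unstar K \<inter> I = {\<zero>}"
  shows "K \<inter> star I = {\<zero>\<^bsub>M\<^esub>}"
proof -
  have "K \<inter> star I \<subseteq> star (unstar K \<inter> I)"
    using subset_star_unstar[OF assms(1)] by (auto simp: star_Int)
  also have "\<dots> = {\<zero>\<^bsub>M\<^esub>}"
    by (simp add: assms(3) star_zero)
  finally show ?thesis
    using M.nearring_idealD(2)[OF assms(1)]
      M.nearring_idealD(2)[OF nearring_ideal_star[OF assms(2)]] by blast
qed

text \<open>For a competitor \<open>J\<close> above \<open>star P\<close>, the ideal
  \<open>unstar J\<close> competes with \<open>P\<close>, hence equals \<open>P\<close>. Then
  \<open>J\<close> lies in \<open>star (unstar J) = star P\<close>.\<close>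

lemma complement_of_star:
  assumes K: "nearring_ideal K N" and P: "complement_of P K N"
  shows "complement_of (star P) (star K) M"
proof -
  have idP: "nearring_ideal P N" and PK: "K \<inter> P = {\<zero>}"
    and max: "\<And>J. nearring_ideal J N \<Longrightarrow> K \<inter> J = {\<zero>} \<Longrightarrow> P \<subseteq> J \<Longrightarrow> J = P"
    using P by (auto simp: complement_of_def)
  have "J = star P"
    if J: "nearring_ideal J M" and JK: "star K \<inter> J = {\<zero>\<^bsub>M\<^esub>}" and sub: "star P \<subseteq> J" for J
  proof -
    have "K \<inter> unstar J = {\<zero>}"
      using unstar_Int_eq_zero[OF JK] by (simp add: unstar_star[OF K])
    moreover have "P \<subseteq> unstar J"
      using unstar_mono[OF sub] by (simp add: unstar_star[OF idP])
    ultimately have "unstar J = P"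
      using max nearring_ideal_unstar[OF J] by blast
    then show ?thesis
      using subset_star_unstar[OF J] sub by simp
  qed
  moreover have "star K \<inter> star P = {\<zero>\<^bsub>M\<^esub>}"
    by (simp add: PK star_zero flip: star_Int)
  ultimately show ?thesis
    using nearring_ideal_star[OF idP] by (auto simp: complement_of_def)
qed

lemma complement_of_unstar:
  assumes K: "nearring_ideal K M" and Q: "complement_of Q K M"
  shows "star (unstar Q) = Q" "complement_of (unstar Q) (unstar K) N"
proof -
  have idQ: "nearring_ideal Q M" and QK: "K \<inter> Q = {\<zero>\<^bsub>M\<^esub>}"
    and max: "\<And>J. nearring_ideal J M \<Longrightarrow> K \<inter> J = {\<zero>\<^bsub>M\<^esub>} \<Longrightarrow> Q \<subseteq> J \<Longrightarrow> J = Q"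
    using Q by (auto simp: complement_of_def)
  have id: "nearring_ideal (unstar Q) N"
    using idQ by (rule nearring_ideal_unstar)
  have zero: "unstar K \<inter> unstar Q = {\<zero>}"
    using QK by (rule unstar_Int_eq_zero)
  \<comment> \<open>\<open>Q\<close> lies in \<open>star (unstar Q)\<close>, hence in
    \<open>star I\<close>, which still meets \<open>K\<close> only in zero; maximality of
    \<open>Q\<close> applies. The case \<open>I = unstar Q\<close> gives the first claim.\<close>
  have max': "star I = Q"
    if "nearring_ideal I N" "unstar K \<inter> I = {\<zero>}" "unstar Q \<subseteq> I" for I
    using max[OF nearring_ideal_star[OF that(1)] star_Int_eq_zero[OF K that(1,2)]]
      subset_star_unstar[OF idQ] star_mono[OF that(3)] by blast
  show "star (unstar Q) = Q"
    using id zero by (rule max') simp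
  \<comment> \<open>Applying \<open>unstar\<close> to \<open>star I = Q\<close> yields
    \<open>I = unstar Q\<close>, which is the required maximality.\<close>
  show "complement_of (unstar Q) (unstar K) N"
    unfolding complement_of_def using id zero max' unstar_star by metis
qed

text \<open>The maps \<open>star\<close> and \<open>unstar\<close> are mutually inverse here; the
  ideal witnessing a complement is transported by the same map as the complement itself.\<close>

lemma bij_betw_star:
  "bij_betw star {P. complement_ideal P N} {Q. complement_ideal Q M}"
proof (rule bij_betw_byWitness[where f' = unstar])
  show "\<forall>P\<in>{P. complement_ideal P N}. unstar (star P) = P"
    using unstar_star by (auto simp: complement_ideal_def complement_of_def)
  show "\<forall>Q\<in>{Q. complement_ideal Q M}. star (unstar Q) = Q"
    using complement_of_unstar(1) by (auto simp: complement_ideal_def)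
  show "star ` {P. complement_ideal P N} \<subseteq> {Q. complement_ideal Q M}"
    unfolding complement_ideal_def using complement_of_star nearring_ideal_star by blast
  show "unstar ` {Q. complement_ideal Q M} \<subseteq> {P. complement_ideal P N}"
    unfolding complement_ideal_def using complement_of_unstar(2) nearring_ideal_unstar by blast
qed

end

theorem theorem3p12:
  fixes N :: "('a, 'b) ring_scheme" and n :: nat
  assumes "nearring N"
    and "monoid N"
    and "n \<ge> 1"
  shows "bij_betw (ideal_star n N)
           {P. complement_ideal P N}
           {Q. complement_ideal Q (matrix_nearring n N)}"
proof -
  interpret matrix_nearring_context N n
    using assms by (intro matrix_nearring_context.intro matrix_nearring_context_axioms.intro)
  show ?thesis by (rule bij_betw_star)
qed

end
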